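(* For every integer $n\ge 3$, the weak set-labeling number of the wheel graph $W_{n+1}=C_n+K_1$ is $\sigma^{\ast}(W_{n+1})=3+\lfloor \frac{n}{2}\rfloor$.
   Context: All graphs are simple, finite and have no isolated vertices. $\mathbb{N}_0$ is the set of non-negative integers, $\mathcal{P}(X)$ is the power set of $X$, and for finite sets $A,B\subset\mathbb{N}_0$ the sumset is $A+B=\{a+b: a\in A, b\in B\}$. Let $X\subset\mathbb{N}_0$ be a non-empty finite set (the ground set). An integer additive set-labeling (IASL) of a graph $G$ with respect to $X$ is an injective function $f:V(G)\to\mathcal{P}(X)$ such that the induced edge function $f^+(uv)=f(u)+f(v)$, $uv\in E(G)$, takes values in $\mathcal{P}(X)$ (i.e. $f(u)+f(v)\subseteq X$ for every edge $uv$). An IASL $f$ is a weak integer additive set-labeling (WIASL) if $|f^+(uv)|=\max(|f(u)|,|f(v)|)$ for every edge $uv\in E(G)$. A labeling is $1$-uniform if $|f^+(uv)|=1$ for every edge $uv$; throughout, only labelings that are not $1$-uniform are considered. The weak set-labeling number $\sigma^{\ast}(G)$ is the minimum cardinality of a ground set $X$ such that $G$ admits a (not $1$-uniform) WIASL with respect to $X$. The wheel graph $W_{n+1}=C_n+K_1$ (join of graphs) is obtained from the cycle $C_n$ on $n$ vertices by adding one new vertex adjacent to all vertices of $C_n$. *)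

theory Defs
  imports "Graph_Theory.Pair_Digraph" "HOL-Library.Set_Algebras"
begin

(* A finite simple graph is a pair_graph: every edge uv is present as both arcs (u, v) and (v, u).
   On nat set, + is the sumset (Set_Algebras). *)

definition iasl :: "'a pair_pre_digraph \<Rightarrow> nat set \<Rightarrow> ('a \<Rightarrow> nat set) \<Rightarrow> bool" where
  "iasl G X f \<longleftrightarrow>
     inj_on f (pverts G) \<and> f ` pverts G \<subseteq> Pow X \<and>
     (\<forall>(u, v) \<in> parcs G. f u + f v \<in> Pow X)"

definition wiasl :: "'a pair_pre_digraph \<Rightarrow> nat set \<Rightarrow> ('a \<Rightarrow> nat set) \<Rightarrow> bool" where
  "wiasl G X f \<longleftrightarrow>
     iasl G X f \<and> (\<forall>(u, v) \<in> parcs G. card (f u + f v) = max (card (f u)) (card (f v)))"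

definition one_uniform :: "'a pair_pre_digraph \<Rightarrow> ('a \<Rightarrow> nat set) \<Rightarrow> bool" where
  "one_uniform G f \<longleftrightarrow> (\<forall>(u, v) \<in> parcs G. card (f u + f v) = 1)"

(* If no ground set admits such a labeling, the value is unspecified (LEAST over an empty
   predicate). *)
definition weak_set_labeling_number :: "'a pair_pre_digraph \<Rightarrow> nat" where
  "weak_set_labeling_number G =
     (LEAST k. \<exists>X. finite X \<and> X \<noteq> {} \<and> card X = k \<and>
        (\<exists>f. wiasl G X f \<and> \<not> one_uniform G f))"

(* Only meant for n \<ge> 3: below that the arcs degenerate to a loop or a single edge. *)
definition cycle_graph :: "nat \<Rightarrow> nat pair_pre_digraph" where
  "cycle_graph n =
     \<lparr> pverts = {0..<n},
       parcs = {(i, j). i < n \<and> j < n \<and> (j = (i + 1) mod n \<or> i = (j + 1) mod n)} \<rparr>"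

definition single_vertex_graph :: "unit pair_pre_digraph" where
  "single_vertex_graph = \<lparr> pverts = {()}, parcs = {} \<rparr>"

definition graph_join ::
  "'a pair_pre_digraph \<Rightarrow> 'b pair_pre_digraph \<Rightarrow> ('a + 'b) pair_pre_digraph" where
  "graph_join G H =
     \<lparr> pverts = pverts G <+> pverts H,
       parcs = map_prod Inl Inl ` parcs G \<union> map_prod Inr Inr ` parcs H
             \<union> Inl ` pverts G \<times> Inr ` pverts H \<union> Inr ` pverts H \<times> Inl ` pverts G \<rparr>"

(* wheel n is C_n + K_1, written W_{n+1} after its number of vertices. *)
definition wheel :: "nat \<Rightarrow> (nat + unit) pair_pre_digraph" where
  "wheel n = graph_join (cycle_graph n) single_vertex_graph"

lemma pair_graph_cycle:
  assumes "n \<ge> 3"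
  shows "pair_graph (cycle_graph n)"
proof -
  have fin: "finite (parcs (cycle_graph n))"
    by (rule finite_subset[of _ "{0..<n} \<times> {0..<n}"]) (auto simp: cycle_graph_def)
  have noloop: "Suc i mod n \<noteq> i" "i \<noteq> Suc i mod n" if "i < n" for i
    using that assms by (cases "Suc i = n"; auto)+
  show ?thesis
    by unfold_locales
      (use fin noloop in \<open>auto simp: cycle_graph_def symmetric_def intro!: symI\<close>)
qed

lemma arcs_graph_join:
  "(Inl a, Inl b) \<in> parcs (graph_join G H) \<longleftrightarrow> (a, b) \<in> parcs G"
  "(Inr c, Inr d) \<in> parcs (graph_join G H) \<longleftrightarrow> (c, d) \<in> parcs H"
  "(Inl a, Inr d) \<in> parcs (graph_join G H) \<longleftrightarrow> a \<in> pverts G \<and> d \<in> pverts H"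
  "(Inr d, Inl a) \<in> parcs (graph_join G H) \<longleftrightarrow> a \<in> pverts G \<and> d \<in> pverts H"
  by (force simp: graph_join_def image_iff)+

lemma pair_graph_join:
  assumes "pair_graph G" "pair_graph H"
  shows "pair_graph (graph_join G H)"
proof -
  interpret G: pair_graph G by fact
  interpret H: pair_graph H by fact
  have sym: "sym (parcs G)" "sym (parcs H)"
    using G.pair_sym_arcs H.pair_sym_arcs by (auto simp: symmetric_def)
  have "sym (parcs (graph_join G H))"
  proof (rule symI)
    fix x y assume "(x, y) \<in> parcs (graph_join G H)"
    then show "(y, x) \<in> parcs (graph_join G H)"
      by (cases x; cases y) (auto simp: arcs_graph_join dest: symD[OF sym(1)] symD[OF sym(2)])
  qed
  then show ?thesis
    by unfold_locales
      (auto simp: graph_join_def symmetric_def dest: G.wellformed' H.wellformed'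
        G.pair_no_loops H.pair_no_loops)
qed

lemma pair_graph_wheel:
  assumes "n \<ge> 3"
  shows "pair_graph (wheel n)"
proof -
  have "pair_graph single_vertex_graph"
    by unfold_locales (auto simp: single_vertex_graph_def symmetric_def sym_def)
  then show ?thesis
    using assms by (simp add: wheel_def pair_graph_join pair_graph_cycle)
qed

lemma no_isolated_wheel:
  assumes "n \<ge> 3" "u \<in> pverts (wheel n)"
  shows "\<exists>v. (u, v) \<in> parcs (wheel n)"
proof -
  have "0 \<in> pverts (cycle_graph n)"
    using assms(1) by (simp add: cycle_graph_def)
  with assms(2) show ?thesis
    by (auto simp: wheel_def graph_join_def single_vertex_graph_def)
qed

end

theory Submission
  imports Defs
begin

text \<open>
  In a weak labeling every edge has an endpoint whose label is a singleton. Let \<open>T\<close> be the set of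
  vertices with singleton labels, \<open>v \<in> T\<close> the one with the largest label \<open>{m}\<close>, and \<open>U\<close> the union of
  the labels of the neighbours of \<open>v\<close>. The ground set contains the \<open>card T\<close> singleton values, all
  \<open>\<le> m\<close>, and the numbers \<open>m + u\<close> for \<open>u \<in> U - {0}\<close>, all \<open>> m\<close>. Every vertex of the wheel has three
  neighbours with distinct labels, so \<open>U - {0} \<noteq> {}\<close>, which suffices unless half of the rim
  of an even cycle is labeled by non-singletons. In that case these alternate with the singletons,
  and \<open>U\<close> has at least three elements.

  Conversely, with \<open>p = n div 2\<close>, the ground set \<open>{0..p + 2}\<close> is enough: label the hub \<open>{0}\<close> and the rim
  \<open>{1}, {0, p}, {2}, {0, p - 1}, {3}, \<dots>\<close> in cyclic order.
\<close>

section \<open>Sumsets and weak labelings of arbitrary graphs\<close>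

text \<open>The translate of \<open>A\<close> by \<open>Min B\<close> has \<open>card A\<close>
  elements and lies in the sumset, but it misses \<open>Max A + Max B\<close> as soon as
  \<open>Min B < Max B\<close>.\<close>

lemma card_less_card_sumset:
  fixes A B :: "nat set"
  assumes "finite A" "finite B" "A \<noteq> {}" "card B \<ge> 2"
  shows "card A < card (A + B)"
proof -
  have B: "B \<noteq> {}" using assms(4) by auto
  have "Min B \<noteq> Max B"
  proof
    assume "Min B = Max B"
    then have "B \<subseteq> {Max B}"
      using assms(2) by (metis Max_ge Min_le antisym singletonI subsetI)
    then have "card B \<le> 1"
      using card_mono[of "{Max B}" B] by simp
    then show False using assms(4) by simp
  qed
  then have lt: "Min B < Max B"
    using Min_le[OF assms(2) Max_in[OF assms(2) B]] by simp
  have "Max A + Max B \<noteq> a + Min B" if "a \<in> A" for a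
    using Max_ge[OF assms(1) that] lt by linarith
  then have notin: "Max A + Max B \<notin> (\<lambda>a. a + Min B) ` A"
    by auto
  have "insert (Max A + Max B) ((\<lambda>a. a + Min B) ` A) \<subseteq> A + B"
    using Max_in[OF assms(1,3)] Max_in[OF assms(2) B] Min_in[OF assms(2) B]
    by (auto intro: set_plus_intro)
  then have "card (insert (Max A + Max B) ((\<lambda>a. a + Min B) ` A)) \<le> card (A + B)"
    using assms by (intro card_mono finite_set_plus)
  then show ?thesis
    using notin assms(1) by (simp add: card_image)
qed

lemma wiasl_subset:
  assumes "wiasl G X f" "u \<in> pverts G"
  shows "f u \<subseteq> X"
  using assms by (auto simp: wiasl_def iasl_def)

lemma wiasl_sumset_subset:
  assumes "wiasl G X f" "(u, v) \<in> parcs G"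
  shows "f u + f v \<subseteq> X"
  using assms by (auto simp: wiasl_def iasl_def)

lemma wiasl_card_sumset:
  assumes "wiasl G X f" "(u, v) \<in> parcs G"
  shows "card (f u + f v) = max (card (f u)) (card (f v))"
  using assms by (auto simp: wiasl_def)

lemma wiasl_inj:
  assumes "wiasl G X f"
  shows "inj_on f (pverts G)"
  using assms by (auto simp: wiasl_def iasl_def)

text \<open>An empty label makes the sumset empty, so the weak condition forces the other endpoint
  to be labeled by the empty set too, against injectivity.\<close>

lemma wiasl_nonempty:
  assumes "pair_graph G" "wiasl G X f" "finite X" "(u, v) \<in> parcs G"
  shows "f u \<noteq> {}"
proof
  interpret pair_graph G by fact
  assume empty: "f u = {}"
  have uv: "u \<in> pverts G" "v \<in> pverts G" "u \<noteq> v"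
    using wellformed'[OF assms(4)] no_loops'[OF assms(4)] by auto
  have "f u + f v = {}"
    using empty by (auto simp: set_plus_def)
  then have "card (f v) = 0"
    using wiasl_card_sumset[OF assms(2,4)] by simp
  then have "f v = {}"
    using finite_subset[OF wiasl_subset[OF assms(2) uv(2)] assms(3)] by simp
  then show False
    using wiasl_inj[OF assms(2)] uv empty by (auto dest: inj_onD)
qed

text \<open>If both labels had two or more elements, the sumset would be strictly larger than each
  of them, hence larger than their maximum.\<close>

lemma wiasl_singleton_endpoint:
  assumes "pair_graph G" "wiasl G X f" "finite X" "(u, v) \<in> parcs G"
  shows "card (f u) = 1 \<or> card (f v) = 1"
proof (rule ccontr)
  interpret pair_graph G by fact
  assume contr: "\<not> ?thesis"
  have vu: "(v, u) \<in> parcs G"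
    using assms(4) arcs_symmetric by simp
  have "u \<in> pverts G" "v \<in> pverts G"
    using wellformed'[OF assms(4)] by auto
  then have fin: "finite (f u)" "finite (f v)"
    using finite_subset[OF wiasl_subset[OF assms(2)] assms(3)] by auto
  have ne: "f u \<noteq> {}" "f v \<noteq> {}"
    using wiasl_nonempty[OF assms(1-3)] assms(4) vu by auto
  then have "card (f u) \<noteq> 0" "card (f v) \<noteq> 0"
    using fin by auto
  then have "card (f u) \<ge> 2" "card (f v) \<ge> 2"
    using contr by linarith+
  then have "card (f u) < card (f u + f v)" "card (f v) < card (f u + f v)"
    using card_less_card_sumset[OF fin ne(1)] card_less_card_sumset[OF fin(2,1) ne(2)]
    by (simp_all add: add.commute)
  then show False
    using wiasl_card_sumset[OF assms(2,4)] by simp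
qed

lemma card_ground_set_ge:
  assumes wf: "pair_graph G" and w: "wiasl G X f" and X: "finite X"
    and T: "T \<subseteq> pverts G" "T \<noteq> {}" "\<And>v. v \<in> T \<Longrightarrow> card (f v) = 1"
  obtains v where "v \<in> T"
    "card T + card ((\<Union>w \<in> {w. (v, w) \<in> parcs G}. f w) - {0}) \<le> card X"
proof -
  interpret pair_graph G by fact
  define g where "g v = the_elem (f v)" for v
  have f: "f v = {g v}" if v: "v \<in> T" for v
  proof -
    obtain a where "f v = {a}"
      using card_1_singletonE[OF T(3)[OF v]] .
    then show ?thesis by (simp add: g_def)
  qed
  have finT: "finite T"
    using T(1) by (rule finite_subset) simp
  have "inj_on g T"
    using inj_onD[OF inj_on_subset[OF wiasl_inj[OF w] T(1)]] by (intro inj_onI) (simp add: f)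
  then have card_gT: "card (g ` T) = card T"
    by (rule card_image)
  have "Max (g ` T) \<in> g ` T"
    using finT T(2) by (intro Max_in) auto
  then obtain v where v: "v \<in> T" "g v = Max (g ` T)"
    by auto
  have le: "x \<le> g v" if "x \<in> g ` T" for x
    using that finT v(2) by auto
  define U where "U = (\<Union>w \<in> {w. (v, w) \<in> parcs G}. f w)"
  have sub: "(+) (g v) ` (U - {0}) \<subseteq> X"
  proof
    fix y assume "y \<in> (+) (g v) ` (U - {0})"
    then obtain w x where "(v, w) \<in> parcs G" "x \<in> f w" "y = g v + x"
      by (auto simp: U_def)
    then show "y \<in> X"
      using wiasl_sumset_subset[OF w, of v w] f[OF v(1)] set_plus_intro[of "g v" "f v" x "f w"]
      by auto
  qed
  have "g ` T \<subseteq> X"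
  proof
    fix x assume "x \<in> g ` T"
    then obtain u where "u \<in> T" "x = g u" by auto
    then show "x \<in> X"
      using wiasl_subset[OF w, of u] T(1) f by auto
  qed
  then have "card (g ` T \<union> (+) (g v) ` (U - {0})) \<le> card X"
    using sub X by (intro card_mono) auto
  moreover have "g ` T \<inter> (+) (g v) ` (U - {0}) = {}"
    using le by force
  ultimately have "card T + card (U - {0}) \<le> card X"
    using card_gT finT finite_subset[OF sub X]
    by (simp add: card_Un_disjoint card_image)
  then show ?thesis
    using that v(1) unfolding U_def by blast
qed

text \<open>Distinct nonempty labels are distinct nonempty subsets of their union. This turns a
  count of neighbours into a lower bound on the union of their labels.\<close>

lemma card_Union_labels:
  assumes "finite (\<Union> (f ` W))" "inj_on f W" "\<And>w. w \<in> W \<Longrightarrow> f w \<noteq> {}"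
  shows "card W < 2 ^ card (\<Union> (f ` W))"
proof -
  have "{} \<notin> f ` W" "{} \<in> Pow (\<Union> (f ` W))"
    using assms(3) by auto
  then have "f ` W \<subset> Pow (\<Union> (f ` W))"
    by (intro psubsetI subset_Pow_Union) auto
  then have "card (f ` W) < card (Pow (\<Union> (f ` W)))"
    using assms(1) by (intro psubset_card_mono) auto
  then show ?thesis
    using assms(1,2) by (simp add: card_image card_Pow)
qed

section \<open>Independent sets in a cycle\<close>

lemma cyclic_succ_inj: "inj_on (\<lambda>i. Suc i mod n) {0..<n}"
proof (rule inj_onI)
  fix i j assume "i \<in> {0..<n}" "j \<in> {0..<n}" "Suc i mod n = Suc j mod n"
  then show "i = j"
    by (cases "Suc i = n"; cases "Suc j = n") simp_all
qed

text \<open>Supplies the predecessor of a rim vertex without treating position 0 separately.\<close>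

lemma cyclic_succ_surj: "(\<lambda>i. Suc i mod n) ` {0..<n} = {0..<n}"
  by (rule endo_inj_surj[OF _ _ cyclic_succ_inj]) auto

text \<open>The set \<open>I\<close> and its shift \<open>J\<close> are disjoint and equally large.
  If \<open>2 * card I = n\<close>, they partition the cycle, so membership in \<open>I\<close>
  alternates; the last two claims give this for the successor and the predecessor of a position
  outside \<open>I\<close>.\<close>

lemma cyclic_independent_card:
  assumes I: "I \<subseteq> {0..<n}" and ind: "\<forall>i\<in>I. Suc i mod n \<notin> I"
  shows "2 * card I \<le> n"
    and "2 * card I = n \<Longrightarrow> i < n \<Longrightarrow> i \<notin> I \<Longrightarrow> Suc i mod n \<in> I"
    and "2 * card I = n \<Longrightarrow> i < n \<Longrightarrow> Suc i mod n \<notin> I \<Longrightarrow> i \<in> I"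
proof -
  define J where "J = (\<lambda>i. Suc i mod n) ` I"
  have fin: "finite I" "finite J"
    using I finite_subset by (auto simp: J_def)
  have J: "J \<subseteq> {0..<n}" "I \<inter> J = {}"
    using I ind by (auto simp: J_def)
  have "card J = card I"
    unfolding J_def by (rule card_image[OF inj_on_subset[OF cyclic_succ_inj I]])
  then have card: "card (I \<union> J) = 2 * card I"
    using fin J(2) by (simp add: card_Un_disjoint)
  show "2 * card I \<le> n"
    using card card_mono[of "{0..<n}" "I \<union> J"] I J(1) by simp
  assume "2 * card I = n" and i: "i < n"
  then have IJ: "I \<union> J = {0..<n}"
    using card I J(1) by (intro card_subset_eq) auto
  show "i \<in> I" if "Suc i mod n \<notin> I"
  proof -
    have "Suc i mod n \<in> {0..<n}" using i by simp
    then have "Suc i mod n \<in> J" using that IJ by blast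
    then obtain j where "j \<in> I" "Suc i mod n = Suc j mod n"
      by (auto simp: J_def)
    then show ?thesis
      using inj_onD[OF cyclic_succ_inj[of n], of i j] i I by auto
  qed
  then show "Suc i mod n \<in> I" if "i \<notin> I"
    using that by blast
qed

section \<open>Neighbourhoods in the wheel and the lower bound\<close>

lemma pverts_wheel: "pverts (wheel n) = insert (Inr ()) (Inl ` {0..<n})"
  by (auto simp: wheel_def graph_join_def cycle_graph_def single_vertex_graph_def)

lemma parcs_wheel:
  "(Inl i, Inl j) \<in> parcs (wheel n) \<longleftrightarrow>
     i < n \<and> j < n \<and> (j = Suc i mod n \<or> i = Suc j mod n)"
  "(Inl i, Inr z) \<in> parcs (wheel n) \<longleftrightarrow> i < n"
  "(Inr z, Inl i) \<in> parcs (wheel n) \<longleftrightarrow> i < n"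
  "(Inr z, Inr z') \<notin> parcs (wheel n)"
  by (auto simp: wheel_def arcs_graph_join cycle_graph_def single_vertex_graph_def)

lemma wheel_rim_neighbours:
  assumes "n \<ge> 3" "i < n"
  obtains j k where "j < n" "k < n" "j \<noteq> k" "j = Suc i mod n" "i = Suc k mod n"
proof -
  have "i \<in> (\<lambda>i. Suc i mod n) ` {0..<n}"
    using assms(2) cyclic_succ_surj by simp
  then obtain k where k: "k < n" "i = Suc k mod n"
    by auto
  \<comment> \<open>Successor and predecessor could agree only if two steps returned to the start,
    which \<open>n \<ge> 3\<close> excludes.\<close>
  have "Suc i mod n \<noteq> k"
    using k assms by (auto simp: mod_Suc split: if_splits)
  then show ?thesis
    using that[of "Suc i mod n" k] k assms by auto
qed

text \<open>Three neighbours give \<open>3 < 2 ^ card U\<close>, hence at least two elements. The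
  hub of a wheel with \<open>n \<ge> 4\<close> has at least four neighbours, and
  \<open>4 < 2 ^ card U\<close> forces a third element.\<close>

lemma wheel_neighbourhood_card_ge:
  assumes n: "n \<ge> 3" and w: "wiasl (wheel n) X f" and X: "finite X" and v: "v \<in> pverts (wheel n)"
  defines "U \<equiv> \<Union>w \<in> {w. (v, w) \<in> parcs (wheel n)}. f w"
  shows "card U \<ge> 2" and "v = Inr () \<Longrightarrow> n \<ge> 4 \<Longrightarrow> card U \<ge> 3"
proof -
  interpret pair_graph "wheel n" using n by (rule pair_graph_wheel)
  define W where "W = {w. (v, w) \<in> parcs (wheel n)}"
  have W: "W \<subseteq> pverts (wheel n)"
    using wellformed' by (auto simp: W_def)
  have "U \<subseteq> X"
    using W wiasl_subset[OF w] unfolding U_def W_def by blast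
  then have finU: "finite U" using X by (rule finite_subset)
  have ne: "f w \<noteq> {}" if "w \<in> W" for w
    using that wiasl_nonempty[OF pair_graph_wheel[OF n] w X, of w v] arcs_symmetric
    by (auto simp: W_def)
  have lt: "card W < 2 ^ card U"
    using card_Union_labels[of f W] finU inj_on_subset[OF wiasl_inj[OF w] W] ne
    by (simp add: U_def W_def)
  have finW: "finite W" using W by (rule finite_subset) simp
  have hub: "card W \<ge> n" if "v = Inr ()"
  proof -
    have "Inl ` {0..<n} \<subseteq> W" using that by (auto simp: W_def parcs_wheel)
    then show ?thesis
      using card_mono[OF finW, of "Inl ` {0..<n}"] by (simp add: card_image)
  qed
  have "card W \<ge> 3"
  proof (cases v)
    case (Inl i)
    then have "i < n" using v by (auto simp: pverts_wheel)
    then obtain j k where "j < n" "k < n" "j \<noteq> k" "j = Suc i mod n" "i = Suc k mod n"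
      using n wheel_rim_neighbours by metis
    then have "{Inl j, Inl k, Inr ()} \<subseteq> W" "j \<noteq> k"
      using Inl \<open>i < n\<close> by (auto simp: W_def parcs_wheel)
    then show ?thesis
      using card_mono[OF finW, of "{Inl j, Inl k, Inr ()}"] by simp
  next
    case (Inr z)
    then show ?thesis using hub n by simp
  qed
  show "card U \<ge> 2"
  proof (rule ccontr)
    assume "\<not> ?thesis"
    then have "card U \<le> 1" by simp
    then have "(2::nat) ^ card U \<le> 2 ^ 1" by (intro power_increasing) auto
    then show False using lt \<open>card W \<ge> 3\<close> by simp
  qed
  show "card U \<ge> 3" if "v = Inr ()" "n \<ge> 4"
  proof (rule ccontr)
    assume "\<not> ?thesis"
    then have "card U \<le> 2" by simp
    then have "(2::nat) ^ card U \<le> 2 ^ 2" by (intro power_increasing) auto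
    then show False using lt hub that by simp
  qed
qed

lemma wheel_card_ground_set_ge:
  assumes n: "n \<ge> 3" and w: "wiasl (wheel n) X f" and X: "finite X"
  shows "3 + n div 2 \<le> card X"
proof -
  note G = pair_graph_wheel[OF n]
  interpret pair_graph "wheel n" by (rule G)
  define T where "T = {v \<in> pverts (wheel n). card (f v) = 1}"
  define I where "I = {i \<in> {0..<n}. card (f (Inl i)) \<noteq> 1}"
  define U where "U v = (\<Union>w \<in> {w. (v, w) \<in> parcs (wheel n)}. f w)" for v
  have I: "I \<subseteq> {0..<n}" by (auto simp: I_def)
  have single: "card (f u) = 1 \<or> card (f v) = 1" if "(u, v) \<in> parcs (wheel n)" for u v
    using wiasl_singleton_endpoint[OF G w X that] .
  have ind: "\<forall>i\<in>I. Suc i mod n \<notin> I"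
  proof
    fix i assume "i \<in> I"
    then show "Suc i mod n \<notin> I"
      using single[of "Inl i" "Inl (Suc i mod n)"] by (auto simp: I_def parcs_wheel)
  qed
  note alt = cyclic_independent_card[OF I ind]
  have rim_card: "card (Inl ` ({0..<n} - I) :: (nat + unit) set) = n - card I"
    using card_Diff_subset[OF finite_subset[OF I] I] by (simp add: card_image)
  have finT: "finite T" by (simp add: T_def)
  have rim: "Inl ` ({0..<n} - I) \<subseteq> T"
    by (auto simp: T_def I_def pverts_wheel)
  have cT: "n - card I \<le> card T"
    using card_mono[OF finT rim] rim_card by simp
  have "T \<noteq> {}"
  proof
    assume "T = {}"
    then have "n - card I = 0" using cT by simp
    then show False using alt(1) n by simp
  qed
  have T: "T \<subseteq> pverts (wheel n)" "\<And>v. v \<in> T \<Longrightarrow> card (f v) = 1"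
    by (auto simp: T_def)
  obtain v where v: "v \<in> T" "card T + card (U v - {0}) \<le> card X"
    using card_ground_set_ge[OF G w X T(1) \<open>T \<noteq> {}\<close> T(2)] unfolding U_def .
  have vV: "v \<in> pverts (wheel n)" using v(1) by (simp add: T_def)
  have cU: "card (U v) \<ge> 2" "v = Inr () \<Longrightarrow> n \<ge> 4 \<Longrightarrow> card (U v) \<ge> 3"
    using wheel_neighbourhood_card_ge[OF n w X vV] by (simp_all only: U_def)
  have U0: "card (U v - {0}) \<ge> card (U v) - 1"
    using diff_card_le_card_Diff[of "{0}" "U v"] by simp
  show ?thesis
  proof (cases "card (f (Inr ())) = 1")
    case False
    \<comment> \<open>Each spoke needs a singleton endpoint, so all rim labels are singletons. The
      resulting bound \<open>n + 1\<close> is at least \<open>3 + n div 2\<close> for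
      \<open>n \<ge> 3\<close>.\<close>
    then have "I = {}"
      using single[of "Inr ()" "Inl i" for i] by (auto simp: I_def parcs_wheel)
    then show ?thesis
      using cT v(2) U0 cU(1) n by simp
  next
    case True
    then have "insert (Inr ()) (Inl ` ({0..<n} - I)) \<subseteq> T"
      using rim by (auto simp: T_def pverts_wheel)
    from card_mono[OF finT this] have cT': "n - card I + 1 \<le> card T"
      using rim_card by (subst (asm) card_insert_disjoint) auto
    show ?thesis
    proof (cases "2 * card I = n")
      \<comment> \<open>Now \<open>2 * card I < n\<close>, so the rim has at least
        \<open>n div 2 + 1\<close> singletons. The hub adds one more, and a nonzero element of
        \<open>U v\<close> gives the last.\<close>
      case False
      then show ?thesis
        using alt(1) cT' v(2) U0 cU(1) by linarith
    next
      case half: True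
      \<comment> \<open>Here the rim has only \<open>n div 2\<close> singletons, so two nonzero
        elements of \<open>U v\<close> are required.\<close>
      have "card (U v) \<ge> 3"
      proof (cases v)
        case (Inr z)
        \<comment> \<open>Half of the rim being in \<open>I\<close> makes \<open>n\<close> even,
          which leaves \<open>n \<ge> 4\<close>.\<close>
        have "n \<noteq> 3" using half by presburger
        then show ?thesis using cU(2) Inr n by simp
      next
        case (Inl i)
        have i: "i < n" "i \<notin> I"
          using v(1) Inl by (auto simp: T_def I_def pverts_wheel)
        obtain j k where jk: "j < n" "k < n" "j \<noteq> k" "j = Suc i mod n" "i = Suc k mod n"
          using wheel_rim_neighbours[OF n i(1)] .
        have jkI: "j \<in> I" "k \<in> I"
          using alt(2)[OF half i] alt(3)[OF half jk(2)] jk i(2) by auto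
        have arcs: "(v, Inl j) \<in> parcs (wheel n)" "(v, Inl k) \<in> parcs (wheel n)"
          using jk i Inl by (auto simp: parcs_wheel)
        then have sub: "f (Inl j) \<subseteq> U v" "f (Inl k) \<subseteq> U v"
          by (auto simp: U_def)
        have "U v \<subseteq> X"
          using wiasl_subset[OF w] wellformed' unfolding U_def by blast
        then have finU: "finite (U v)" using X by (rule finite_subset)
        have ge2: "card (f (Inl l)) \<ge> 2" if "l \<in> I" "(v, Inl l) \<in> parcs (wheel n)" for l
        proof -
          have "(Inl l, v) \<in> parcs (wheel n)"
            using that(2) arcs_symmetric by simp
          then have "f (Inl l) \<noteq> {}" by (rule wiasl_nonempty[OF G w X])
          moreover have "finite (f (Inl l))"
            using that(2) finU finite_subset[of "f (Inl l)" "U v"] by (auto simp: U_def)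
          ultimately have "card (f (Inl l)) \<noteq> 0" by simp
          moreover have "card (f (Inl l)) \<noteq> 1" using that(1) by (simp add: I_def)
          ultimately show ?thesis by linarith
        qed
        show ?thesis
        \<comment> \<open>By alternation both rim neighbours of \<open>v\<close> carry labels with
          at least two elements. If \<open>U v\<close> had only two, both labels would equal
          \<open>U v\<close>, against injectivity.\<close>
        proof (rule ccontr)
          assume "\<not> ?thesis"
          then have "f (Inl j) = U v" "f (Inl k) = U v"
            using ge2[OF jkI(1) arcs(1)] ge2[OF jkI(2) arcs(2)]
              card_seteq[OF finU sub(1)] card_seteq[OF finU sub(2)] by simp_all
          then show False
            using inj_onD[OF wiasl_inj[OF w], of "Inl j" "Inl k"] jk(1-3)
            by (simp add: pverts_wheel)
        qed
      qed
      then show ?thesis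
        using half cT' v(2) U0 by linarith
    qed
  qed
qed

section \<open>A labeling that attains the bound\<close>

definition wheel_labeling :: "nat \<Rightarrow> nat + unit \<Rightarrow> nat set" where
  "wheel_labeling n v =
     (case v of
        Inl i \<Rightarrow> if even i then {i div 2 + 1} else {0, n div 2 - i div 2}
      | Inr _ \<Rightarrow> {0})"

text \<open>With \<open>p = n div 2\<close>, singletons count up while doubletons count down, so the
  largest sum stays constant: \<open>(t + 1) + (p - t) = p + 1\<close> between positions
  \<open>2 * t\<close> and \<open>2 * t + 1\<close>, and \<open>(p - t) + (t + 2) = p + 2\<close> on
  the next edge. The closing edge adds \<open>{1}\<close> to \<open>{p + 1}\<close> for odd
  \<open>n\<close> and to \<open>{0, 1}\<close> for even \<open>n\<close>.\<close>

lemma wheel_labeling_rim_edge: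
  assumes "i < n" "j = Suc i mod n"
  shows "wheel_labeling n (Inl i) + wheel_labeling n (Inl j) \<subseteq> {0..n div 2 + 2}"
    and "even i \<or> even j"
proof -
  have cases: "Suc i < n \<and> j = Suc i \<or> Suc i = n \<and> j = 0"
    using assms by (cases "Suc i = n") auto
  show "even i \<or> even j"
    using cases by auto
  show "wheel_labeling n (Inl i) + wheel_labeling n (Inl j) \<subseteq> {0..n div 2 + 2}"
    using cases
  proof
    assume 1: "Suc i < n \<and> j = Suc i"
    have "i div 2 < n div 2 \<or> even i" using 1 by presburger
    moreover have "i div 2 \<le> n div 2" using assms(1) by (simp add: div_le_mono)
    ultimately show ?thesis
      using 1 by (auto simp: wheel_labeling_def set_plus_def)
  next
    assume 2: "Suc i = n \<and> j = 0"
    have "i div 2 \<le> n div 2" using assms(1) by (simp add: div_le_mono)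
    moreover have "j = 0" using 2 by simp
    ultimately show ?thesis
      by (auto simp: wheel_labeling_def set_plus_def)
  qed
qed

lemma wheel_labeling_inj: "inj_on (wheel_labeling n) (pverts (wheel n))"
proof (rule inj_onI)
  have even: "wheel_labeling n (Inl i) = {i div 2 + 1}" if "even i" for i
    using that by (simp add: wheel_labeling_def)
  \<comment> \<open>The strict inequality makes the second element positive, so the label is a
    genuine doubleton, and keeps the natural subtraction from truncating, so \<open>i div 2\<close>
    can be recovered from it.\<close>
  have odd: "wheel_labeling n (Inl i) = {0, n div 2 - i div 2}" "i div 2 < n div 2"
    if "odd i" "i < n" for i
  proof -
    show "wheel_labeling n (Inl i) = {0, n div 2 - i div 2}"
      using that(1) by (simp add: wheel_labeling_def)
    show "i div 2 < n div 2"
      using that by presburger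
  qed
  have hub: "wheel_labeling n (Inr z) = {0}" for z
    by (simp add: wheel_labeling_def)
  have rim_hub: "wheel_labeling n (Inl i) \<noteq> {0}" if "i < n" for i
    using even[of i] odd[of i] that by (cases "even i") auto
  have even_odd: "wheel_labeling n (Inl i) \<noteq> wheel_labeling n (Inl j)"
    if "even i" "odd j" "j < n" for i j
    using even[of i] odd[of j] that by auto
  fix u v
  assume u: "u \<in> pverts (wheel n)" and v: "v \<in> pverts (wheel n)"
    and eq: "wheel_labeling n u = wheel_labeling n v"
  show "u = v"
  proof (cases u; cases v)
    fix i j assume uv: "u = Inl i" "v = Inl j"
    then have ij: "i < n" "j < n" using u v by (auto simp: pverts_wheel)
    have parity: "even i \<longleftrightarrow> even j"
      using even_odd[of i j] even_odd[of j i] ij eq uv by auto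
    have "i div 2 = j div 2"
    proof (cases "even i")
      case True
      then show ?thesis using even parity eq uv by simp
    next
      case False
      then have "{0, n div 2 - i div 2} = {0, n div 2 - j div 2}"
        using odd(1) ij parity eq uv by simp
      then have "n div 2 - i div 2 = n div 2 - j div 2"
        by (auto simp: doubleton_eq_iff)
      then show ?thesis
        using odd(2)[OF False ij(1)] odd(2)[of j] False parity ij by linarith
    qed
    then have "i = j" using parity by presburger
    then show ?thesis using uv by simp
  next
    fix i z assume uv: "u = Inl i" "v = Inr z"
    then have "i < n" using u by (auto simp: pverts_wheel)
    from rim_hub[OF this] show ?thesis using eq hub[of z] unfolding uv by simp
  next
    fix i z assume uv: "u = Inr z" "v = Inl i"
    then have "i < n" using v by (auto simp: pverts_wheel)
    from rim_hub[OF this] show ?thesis using eq hub[of z] unfolding uv by simp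
  qed simp
qed

lemma card_sumset_singleton:
  fixes A :: "nat set"
  shows "card (A + {c}) = card A" "card ({c} + A) = card A"
proof -
  have "A + {c} = (\<lambda>a. a + c) ` A"
    by (auto simp: set_plus_def)
  then show "card (A + {c}) = card A"
    by (simp add: card_image)
  then show "card ({c} + A) = card A"
    by (simp add: add.commute)
qed

lemma wheel_labeling_wiasl: "wiasl (wheel n) {0..n div 2 + 2} (wheel_labeling n)"
proof -
  let ?f = "wheel_labeling n" and ?X = "{0..n div 2 + 2}"
  have sub: "?f v \<subseteq> ?X" if "v \<in> pverts (wheel n)" for v
  proof -
    have "i div 2 \<le> n div 2" if "i < n" for i
      using that by (simp add: div_le_mono)
    then show ?thesis
      using that by (auto simp: wheel_labeling_def pverts_wheel split: if_splits)
  qed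
  have ne: "finite (?f v) \<and> ?f v \<noteq> {}" for v
    by (auto simp: wheel_labeling_def split: sum.splits)
  have card: "card (?f u + ?f v) = max (card (?f u)) (card (?f v))"
    if "card (?f u) = 1 \<or> card (?f v) = 1" for u v
  proof -
    \<comment> \<open>Adding a singleton preserves cardinality; since no label is empty, the
      \<open>max\<close> is then the cardinality of the other label.\<close>
    have pos: "1 \<le> card (?f w)" for w
      using ne[of w] by (simp add: Suc_le_eq card_gt_0_iff)
    show ?thesis
      using that
    proof
      assume "card (?f u) = 1"
      moreover from this obtain a where "?f u = {a}" by (rule card_1_singletonE)
      ultimately show ?thesis
        using pos[of v] by (simp add: card_sumset_singleton)
    next
      assume "card (?f v) = 1"
      moreover from this obtain a where "?f v = {a}" by (rule card_1_singletonE)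
      ultimately show ?thesis
        using pos[of u] by (simp add: card_sumset_singleton)
    qed
  qed
  have even: "card (?f (Inl i)) = 1" if "even i" for i
    using that by (simp add: wheel_labeling_def)
  have hub: "?f (Inr z) = {0}" for z
    by (simp add: wheel_labeling_def)
  have arc: "?f u + ?f v \<subseteq> ?X \<and> (card (?f u) = 1 \<or> card (?f v) = 1)"
    if uv: "(u, v) \<in> parcs (wheel n)" for u v
  proof (cases u; cases v)
    fix i j assume [simp]: "u = Inl i" "v = Inl j"
    have "i < n" "j < n" "j = Suc i mod n \<or> i = Suc j mod n"
      using uv by (simp_all add: parcs_wheel)
    then show ?thesis
      using wheel_labeling_rim_edge[of i n j] wheel_labeling_rim_edge[of j n i] even
      by (auto simp: add.commute[of "?f (Inl i)"])
  next
    fix i z assume [simp]: "u = Inl i" "v = Inr z"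
    show ?thesis
      using uv sub[of "Inl i"] by (auto simp: hub parcs_wheel pverts_wheel set_plus_def)
  next
    fix i z assume [simp]: "u = Inr z" "v = Inl i"
    show ?thesis
      using uv sub[of "Inl i"] by (auto simp: hub parcs_wheel pverts_wheel set_plus_def)
  next
    fix z z' assume "u = Inr z" "v = Inr z'"
    then show ?thesis using uv by (simp add: parcs_wheel)
  qed
  show ?thesis
    unfolding wiasl_def iasl_def using wheel_labeling_inj sub arc card by blast
qed

text \<open>The spoke to rim position 1 is the witness: the hub label \<open>{0}\<close> leaves
  \<open>{0, n div 2}\<close> unchanged, and \<open>n div 2\<close> is positive.\<close>

lemma wheel_labeling_not_one_uniform:
  assumes "n \<ge> 3"
  shows "\<not> one_uniform (wheel n) (wheel_labeling n)"
proof
  assume "one_uniform (wheel n) (wheel_labeling n)"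
  moreover have "(Inl 1, Inr ()) \<in> parcs (wheel n)"
    using assms by (simp add: parcs_wheel)
  ultimately have "card (wheel_labeling n (Inl 1) + wheel_labeling n (Inr ())) = 1"
    unfolding one_uniform_def by blast
  moreover have "wheel_labeling n (Inr ()) = {0}" "wheel_labeling n (Inl 1) = {0, n div 2}"
    by (simp_all add: wheel_labeling_def)
  ultimately show False
    using assms by (simp add: card_sumset_singleton)
qed

theorem theorem3p1:
  fixes n :: nat
  assumes "n \<ge> 3"
  shows "weak_set_labeling_number (wheel n) = 3 + n div 2"
  unfolding weak_set_labeling_number_def
proof (rule Least_equality)
  show "\<exists>X. finite X \<and> X \<noteq> {} \<and> card X = 3 + n div 2 \<and>
      (\<exists>f. wiasl (wheel n) X f \<and> \<not> one_uniform (wheel n) f)"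
    using wheel_labeling_wiasl[of n] wheel_labeling_not_one_uniform[OF assms]
    \<comment> \<open>Counting 0, this interval has \<open>n div 2 + 3\<close> elements.\<close>
    by (intro exI[of _ "{0..n div 2 + 2}"]) auto
next
  fix k
  assume "\<exists>X. finite X \<and> X \<noteq> {} \<and> card X = k \<and>
      (\<exists>f. wiasl (wheel n) X f \<and> \<not> one_uniform (wheel n) f)"
  then show "3 + n div 2 \<le> k"
    using wheel_card_ground_set_ge[OF assms] by auto
qed

end
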